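(* Let $\Phi$ be a finite set of linear transformations mapping $\Delta^n$ to $\Delta^n$. Let $F:\mathbb{R}^{|\Phi|}\to\mathbb{R}$ be a convex differentiable function such that $F(s)\le 0$ for all $s\in\mathbb{R}^{|\Phi|}_{\le 0}$, and such that for some $L>0$, $F(x+y)\le F(x)+\langle\nabla F(x),y\rangle+\frac{L}{2}\|y\|^2$ for all $x,y\in\mathbb{R}^{|\Phi|}$. Let $\eta_1\ge\eta_2\ge\dots\ge\eta_T>0$ be step sizes. Then for every sequence of losses $\ell_1,\dots,\ell_T\in\mathbb{R}^n$ and predictions $m_1,\dots,m_T\in\mathbb{R}^{|\Phi|}$, if in each round $t$ the algorithm plays a fixed point $x_t\in\Delta^n$ of the operator $\tilde M_t^{\Phi}$ (an arbitrary $x_t\in\Delta^n$ if the denominator defining $\tilde M_t^\Phi$ is zero), then $$F(\eta_T s^{\Phi}_{1:T})\le\frac{L}{2}\sum_{t=1}^T\eta_T\,\eta_t\,\|s^{\Phi}_t-m_t\|^2 .$$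
   Context: $\Delta^n\subset\mathbb{R}^n$ is the probability simplex over $n$ actions. $\|\cdot\|$ is a norm on $\mathbb{R}^{|\Phi|}$, vectors in $\mathbb{R}^{|\Phi|}$ are indexed by $\phi\in\Phi$, $\mathbf 1=(1,\dots,1)\in\mathbb{R}^{|\Phi|}$, and $\mathbb{R}^{|\Phi|}_{\le 0}$ is the set of vectors with all entries nonpositive. Learning with expert advice: in each round $t=1,\dots,T$ the algorithm selects $x_t\in\Delta^n$, and then a loss vector $\ell_t\in\mathbb{R}^n$ (arbitrary, possibly chosen adversarially after seeing $x_t$) is revealed. The $\Phi$-regret vector is defined by $s_t^\Phi=\big(\langle\ell_t,x_t\rangle-\langle\ell_t,\phi(x_t)\rangle\big)_{\phi\in\Phi}$, $s^\Phi_{1:0}=0$, and $s^\Phi_{1:t}=s^\Phi_{1:t-1}+s^\Phi_t$. In round $t$, a prediction $m_t\in\mathbb{R}^{|\Phi|}$ is available before $x_t$ is chosen, and with $g_t=\nabla F(\eta_t(s^\Phi_{1:t-1}+m_t))$ the operator is $$\tilde M_t^{\Phi}(x)=\frac{\sum_{\phi\in\Phi}(g_t)_\phi\,\phi(x)}{\langle g_t,\mathbf 1\rangle}.$$ *)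

theory Defs
  imports "HOL-Analysis.Analysis"
begin

definition is_norm :: "('a::real_vector \<Rightarrow> real) \<Rightarrow> bool" where
  "is_norm N \<longleftrightarrow>
     (\<forall>x. 0 \<le> N x) \<and>
     (\<forall>x. N x = 0 \<longleftrightarrow> x = 0) \<and>
     (\<forall>a x. N (a *\<^sub>R x) = \<bar>a\<bar> * N x) \<and>
     (\<forall>x y. N (x + y) \<le> N x + N y)"

definition prob_simplex :: "(real ^ 'n) set" where
  "prob_simplex = {x. (\<forall>i. 0 \<le> x $ i) \<and> (\<Sum>i\<in>UNIV. x $ i) = 1}"

definition gradient :: "('a::real_inner \<Rightarrow> real) \<Rightarrow> 'a \<Rightarrow> 'a" where
  "gradient F x = (THE D. GDERIV F x :> D)"

lemma GDERIV_gradient: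
  fixes F :: "'a::euclidean_space \<Rightarrow> real"
  assumes "F differentiable (at x)"
  shows "GDERIV F x :> gradient F x"
proof -
  obtain F' where F': "(F has_derivative F') (at x)"
    using assms by (auto simp: differentiable_def)
  then interpret bounded_linear F' by (rule has_derivative_bounded_linear)
  have "F' h = inner h (\<Sum>b\<in>Basis. F' b *\<^sub>R b)" for h
  proof -
    have "F' h = F' (\<Sum>b\<in>Basis. (h \<bullet> b) *\<^sub>R b)"
      by (simp add: euclidean_representation)
    also have "\<dots> = (\<Sum>b\<in>Basis. (h \<bullet> b) * F' b)"
      by (simp add: sum scaleR)
    also have "\<dots> = inner h (\<Sum>b\<in>Basis. F' b *\<^sub>R b)"
      by (simp add: inner_sum_right mult.commute)
    finally show ?thesis .
  qed
  then have "F' = (\<lambda>h. inner h (\<Sum>b\<in>Basis. F' b *\<^sub>R b))"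
    by blast
  then have "GDERIV F x :> (\<Sum>b\<in>Basis. F' b *\<^sub>R b)"
    using F' by (simp add: gderiv_def)
  moreover have "D = E" if "GDERIV F x :> D" "GDERIV F x :> E" for D E
  proof -
    have "(\<lambda>h. inner h D) = (\<lambda>h. inner h E)"
      using that unfolding gderiv_def by (rule has_derivative_unique)
    then have "inner h D = inner h E" for h
      by (rule fun_cong)
    then show ?thesis
      using vector_eq_ldot by blast
  qed
  ultimately have "\<exists>!D. GDERIV F x :> D"
    by blast
  then show ?thesis
    unfolding gradient_def by (rule theI')
qed

text \<open>
  A finite set \<open>\<Phi>\<close> of maps is enumerated without repetition by a finite
  index type \<open>'p\<close>, via \<open>phi :: 'p \<Rightarrow> real ^ 'n \<Rightarrow> real ^ 'n\<close> with
  \<open>bij_betw phi UNIV \<Phi>\<close>. A vector indexed by the elements of \<open>\<Phi>\<close> then has type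
  \<open>real ^ 'p\<close>, the entry at \<open>phi i\<close> being its \<open>i\<close>-th component.
\<close>

definition regret_vec ::
  "('p::finite \<Rightarrow> real ^ 'n \<Rightarrow> real ^ 'n) \<Rightarrow> real ^ 'n \<Rightarrow> real ^ 'n \<Rightarrow> real ^ 'p" where
  "regret_vec phi l x = (\<chi> i. l \<bullet> x - l \<bullet> phi i x)"

text \<open>Rounds are numbered from 1; \<open>l 0\<close> and \<open>x 0\<close> are never used.\<close>

primrec cum_regret ::
  "('p::finite \<Rightarrow> real ^ 'n \<Rightarrow> real ^ 'n) \<Rightarrow> (nat \<Rightarrow> real ^ 'n) \<Rightarrow> (nat \<Rightarrow> real ^ 'n) \<Rightarrow>
   nat \<Rightarrow> real ^ 'p" where
  "cum_regret phi l x 0 = 0"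
| "cum_regret phi l x (Suc t) =
     cum_regret phi l x t + regret_vec phi (l (Suc t)) (x (Suc t))"

definition pred_gradient ::
  "(real ^ 'p \<Rightarrow> real) \<Rightarrow> (nat \<Rightarrow> real) \<Rightarrow> ('p::finite \<Rightarrow> real ^ 'n \<Rightarrow> real ^ 'n) \<Rightarrow>
   (nat \<Rightarrow> real ^ 'p) \<Rightarrow> (nat \<Rightarrow> real ^ 'n) \<Rightarrow> (nat \<Rightarrow> real ^ 'n) \<Rightarrow> nat \<Rightarrow> real ^ 'p" where
  "pred_gradient F \<eta> phi m l x t =
     gradient F (\<eta> t *\<^sub>R (cum_regret phi l x (t - 1) + m t))"

text \<open>Meaningful only if \<open>g \<bullet> 1 \<noteq> 0\<close>, where \<open>1\<close> is the all-ones vector.\<close>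

definition phi_operator ::
  "real ^ 'p \<Rightarrow> ('p::finite \<Rightarrow> real ^ 'n \<Rightarrow> real ^ 'n) \<Rightarrow> real ^ 'n \<Rightarrow> real ^ 'n" where
  "phi_operator g phi x = (\<Sum>i\<in>UNIV. (g $ i) *\<^sub>R phi i x) /\<^sub>R (g \<bullet> 1)"

end

theory Submission
  imports Defs
begin

text \<open>
  Since F is convex and nonpositive on the negative orthant, its gradients are
  nonnegative; hence \<open>\<langle>g, 1\<rangle> = 0\<close> forces \<open>g = 0\<close>, and \<open>\<langle>g\<^sub>t, s\<^sub>t\<rangle> = 0\<close> holds in every
  round whether or not the operator is defined. Smoothness at \<open>\<eta>\<^sub>t (s\<^sub>1\<^sub>:\<^sub>t\<^sub>-\<^sub>1 + m\<^sub>t)\<close>,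
  combined with the tangent inequality between that point and \<open>\<eta>\<^sub>t s\<^sub>1\<^sub>:\<^sub>t\<^sub>-\<^sub>1\<close>,
  bounds the growth of F in one round by \<open>L/2 \<eta>\<^sub>t\<^sup>2 \<parallel>s\<^sub>t - m\<^sub>t\<parallel>\<^sup>2\<close>. As \<open>F 0 \<le> 0\<close>, the quotient
  \<open>F (\<eta> s) / \<eta>\<close> is monotone in \<open>\<eta>\<close>, which absorbs the change of step size.
\<close>

text \<open>Restricting \<open>F\<close> to the line through \<open>u\<close> and \<open>w\<close>
  reduces this to the one-dimensional tangent inequality at parameter 0, read off at parameter
  1.\<close>

lemma convex_gradient_le:
  fixes F :: "'a::euclidean_space \<Rightarrow> real"
  assumes "convex_on UNIV F" and "F differentiable (at u)"
  shows "F u + gradient F u \<bullet> (w - u) \<le> F w"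
proof -
  let ?h = "\<lambda>a. F (u + a *\<^sub>R (w - u))"
  have "convex_on UNIV ?h"
  proof (rule convex_onI)
    fix t a b :: real
    assume "0 < t" "t < 1"
    moreover have "u + ((1 - t) *\<^sub>R a + t *\<^sub>R b) *\<^sub>R (w - u)
        = (1 - t) *\<^sub>R (u + a *\<^sub>R (w - u)) + t *\<^sub>R (u + b *\<^sub>R (w - u))"
      by (simp add: algebra_simps)
    ultimately show "?h ((1 - t) *\<^sub>R a + t *\<^sub>R b) \<le> (1 - t) * ?h a + t * ?h b"
      using convex_onD[OF assms(1), of t] by simp
  qed simp
  moreover have "(?h has_real_derivative gradient F u \<bullet> (w - u)) (at 0)"
  proof -
    have "(F has_derivative (\<lambda>h. h \<bullet> gradient F u)) (at (u + 0 *\<^sub>R (w - u)))"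
      using GDERIV_gradient[OF assms(2)] by (simp add: gderiv_def)
    moreover have "((\<lambda>a::real. u + a *\<^sub>R (w - u)) has_derivative (\<lambda>a. a *\<^sub>R (w - u))) (at 0)"
      by (auto intro!: derivative_eq_intros)
    ultimately have "(?h has_derivative (\<lambda>a. (a *\<^sub>R (w - u)) \<bullet> gradient F u)) (at 0)"
      by (rule has_derivative_compose[rotated])
    then show ?thesis
      by (simp add: has_field_derivative_def inner_commute mult_commute_abs)
  qed
  ultimately have "gradient F u \<bullet> (w - u) * (1 - 0) \<le> ?h 1 - ?h 0"
    by (intro convex_on_imp_above_tangent[where A = UNIV]) auto
  then show ?thesis by simp
qed

text \<open>With a negative entry \<open>i\<close>, the tangent at \<open>u\<close>, a lower bound
  for \<open>F\<close>, would become positive far out on the negative \<open>i\<close>-th axis,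
  where \<open>F\<close> is nonpositive.\<close>

lemma gradient_nonneg:
  fixes F :: "real ^ 'p \<Rightarrow> real"
  assumes "convex_on UNIV F" and "F differentiable (at u)"
    and nonpos: "\<And>s. (\<forall>i. s $ i \<le> 0) \<Longrightarrow> F s \<le> 0"
  shows "0 \<le> gradient F u $ i"
proof (rule ccontr)
  let ?g = "gradient F u"
  let ?c = "F u - ?g \<bullet> u"
  assume "\<not> 0 \<le> ?g $ i"
  then have neg: "?g $ i < 0" by simp
  \<comment> \<open>Chosen so that the tangent takes the value
    \<open>?c + \<bar>?c\<bar> + 1 > 0\<close> at \<open>- r *\<^sub>R axis i 1\<close>.\<close>
  define r where "r = (\<bar>?c\<bar> + 1) / - (?g $ i)"
  have "0 \<le> r" unfolding r_def using neg by (intro divide_nonneg_nonneg) auto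
  have "F u + ?g \<bullet> (- r *\<^sub>R axis i 1 - u) \<le> F (- r *\<^sub>R axis i 1)"
    using assms(1,2) by (rule convex_gradient_le)
  also have "\<dots> \<le> 0"
    using \<open>0 \<le> r\<close> by (intro nonpos) (simp add: axis_def)
  finally have "?c - r * (?g $ i) \<le> 0"
    by (simp add: inner_diff_right inner_axis)
  moreover have "r * (?g $ i) = - (\<bar>?c\<bar> + 1)"
    using neg by (simp add: r_def)
  ultimately show False by linarith
qed

lemma inner_one_vec: "g \<bullet> 1 = (\<Sum>i\<in>UNIV. g $ i)" for g :: "real ^ 'p"
  by (simp add: inner_vec_def)

text \<open>At a fixed point the \<open>g\<close>-weighted sum of the \<open>phi i x\<close> is
  \<open>(g \<bullet> 1) *\<^sub>R x\<close>, so the weighted losses cancel for every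
  \<open>l\<close>, even one chosen after \<open>x\<close>.\<close>

lemma inner_regret_vec_eq_0:
  fixes g :: "real ^ 'p"
  assumes "\<And>i. 0 \<le> g $ i"
    and "g \<bullet> 1 \<noteq> 0 \<Longrightarrow> phi_operator g phi x = x"
  shows "g \<bullet> regret_vec phi l x = 0"
proof (cases "g \<bullet> 1 = 0")
  case True
  then have "g = 0"
    using assms(1) by (simp add: inner_one_vec sum_nonneg_eq_0_iff vec_eq_iff)
  then show ?thesis by simp
next
  case False
  then have "(\<Sum>i\<in>UNIV. (g $ i) *\<^sub>R phi i x) = (g \<bullet> 1) *\<^sub>R phi_operator g phi x"
    by (simp add: phi_operator_def)
  also have "\<dots> = (g \<bullet> 1) *\<^sub>R x"
    using False assms(2) by simp
  finally have fixed: "(\<Sum>i\<in>UNIV. (g $ i) *\<^sub>R phi i x) = (g \<bullet> 1) *\<^sub>R x" .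
  have "g \<bullet> regret_vec phi l x = (g \<bullet> 1) * (l \<bullet> x) - l \<bullet> (\<Sum>i\<in>UNIV. (g $ i) *\<^sub>R phi i x)"
    unfolding inner_one_vec
    by (simp add: inner_vec_def[of g] regret_vec_def right_diff_distrib sum_subtractf
        sum_distrib_right inner_sum_right)
  then show ?thesis
    unfolding fixed by simp
qed

text \<open>The point \<open>a *\<^sub>R s\<close> is the convex combination of \<open>0\<close> and
  \<open>b *\<^sub>R s\<close> with weight \<open>a / b\<close> on the latter.\<close>

lemma convex_on_scale_le:
  fixes F :: "'a::real_vector \<Rightarrow> real"
  assumes "convex_on UNIV F" and "F 0 \<le> 0" and "0 < a" and "a \<le> b"
  shows "F (a *\<^sub>R s) \<le> a / b * F (b *\<^sub>R s)"
proof -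
  have "F ((1 - a / b) *\<^sub>R 0 + (a / b) *\<^sub>R (b *\<^sub>R s)) \<le> (1 - a / b) * F 0 + a / b * F (b *\<^sub>R s)"
    using assms by (intro convex_onD) auto
  moreover have "(1 - a / b) * F 0 \<le> 0"
    using assms by (intro mult_nonneg_nonpos) auto
  ultimately show ?thesis
    using assms by simp
qed

theorem theorem3:
  fixes Phi :: "(real ^ 'n \<Rightarrow> real ^ 'n) set"
    and phi :: "'p::finite \<Rightarrow> real ^ 'n \<Rightarrow> real ^ 'n"
    and nrm :: "real ^ 'p \<Rightarrow> real"
    and F :: "real ^ 'p \<Rightarrow> real"
    and L :: real
    and T :: nat
    and \<eta> :: "nat \<Rightarrow> real"
    and l x :: "nat \<Rightarrow> real ^ 'n"
    and m :: "nat \<Rightarrow> real ^ 'p"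
  assumes "finite Phi"
    and "bij_betw phi UNIV Phi"
    and "\<forall>f\<in>Phi. linear f \<and> f ` prob_simplex \<subseteq> prob_simplex"
    and "is_norm nrm"
    and "convex_on UNIV F"
    and "\<forall>s. F differentiable (at s)"
    and "\<forall>s. (\<forall>i. s $ i \<le> 0) \<longrightarrow> F s \<le> 0"
    and "L > 0"
    and "\<forall>u v. F (u + v) \<le> F u + gradient F u \<bullet> v + L / 2 * (nrm v)\<^sup>2"
    and "T \<ge> 1"
    and "\<forall>t\<in>{1..<T}. \<eta> (Suc t) \<le> \<eta> t"
    and "\<eta> T > 0"
    and "\<forall>t\<in>{1..T}. x t \<in> prob_simplex"
    and "\<forall>t\<in>{1..T}. pred_gradient F \<eta> phi m l x t \<bullet> 1 \<noteq> 0 \<longrightarrow>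
           phi_operator (pred_gradient F \<eta> phi m l x t) phi (x t) = x t"
  shows "F (\<eta> T *\<^sub>R cum_regret phi l x T)
           \<le> L / 2 * (\<Sum>t=1..T. \<eta> T * \<eta> t * (nrm (regret_vec phi (l t) (x t) - m t))\<^sup>2)"
proof -
  let ?S = "cum_regret phi l x"
  let ?s = "\<lambda>t. regret_vec phi (l t) (x t)"
  let ?g = "pred_gradient F \<eta> phi m l x"
  let ?e = "\<lambda>t. (nrm (?s t - m t))\<^sup>2"
  have F0: "F 0 \<le> 0" using assms(7) by simp
  have nrm_scale: "nrm (a *\<^sub>R v) = \<bar>a\<bar> * nrm v" for a v
    using assms(4) by (simp add: is_norm_def)
  \<comment> \<open>Positivity is assumed only at \<open>T\<close>, so the induction descends from
    \<open>T\<close> along the monotonicity of the step sizes.\<close>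
  have \<eta>_pos: "0 < \<eta> t" if "1 \<le> t" "t \<le> T" for t
    using that(2) that(1)
  proof (induction t rule: inc_induct)
    case base
    show ?case by (rule assms(12))
  next
    case (step t)
    then have "\<eta> (Suc t) \<le> \<eta> t" "0 < \<eta> (Suc t)" using assms(11) by auto
    then show ?case by linarith
  qed
  have round: "F (\<eta> t *\<^sub>R ?S t) \<le> F (\<eta> t *\<^sub>R ?S (t - 1)) + L / 2 * ((\<eta> t)\<^sup>2 * ?e t)"
    if t: "1 \<le> t" "t \<le> T" for t
  proof -
    let ?u = "\<eta> t *\<^sub>R (?S (t - 1) + m t)"
    have g: "gradient F ?u = ?g t" by (simp add: pred_gradient_def)
    have orth: "?g t \<bullet> ?s t = 0"
    proof (rule inner_regret_vec_eq_0)
      show "0 \<le> ?g t $ i" for i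
        unfolding g[symmetric] using assms(5-7) by (intro gradient_nonneg) auto
      show "?g t \<bullet> 1 \<noteq> 0 \<Longrightarrow> phi_operator (?g t) phi (x t) = x t"
        using assms(14) t by simp
    qed
    have "?S t = ?S (t - 1) + ?s t"
      using t by (cases t) auto
    then have "\<eta> t *\<^sub>R ?S t = ?u + \<eta> t *\<^sub>R (?s t - m t)"
      by (simp add: algebra_simps)
    then have "F (\<eta> t *\<^sub>R ?S t)
        \<le> F ?u + ?g t \<bullet> (\<eta> t *\<^sub>R (?s t - m t)) + L / 2 * (nrm (\<eta> t *\<^sub>R (?s t - m t)))\<^sup>2"
      using assms(9) g by metis
    moreover have "F ?u + ?g t \<bullet> (\<eta> t *\<^sub>R ?S (t - 1) - ?u) \<le> F (\<eta> t *\<^sub>R ?S (t - 1))"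
      unfolding g[symmetric] using assms(5,6) by (intro convex_gradient_le) auto
    moreover have "(nrm (\<eta> t *\<^sub>R (?s t - m t)))\<^sup>2 = (\<eta> t)\<^sup>2 * ?e t"
      by (simp only: nrm_scale power_mult_distrib power2_abs)
    \<comment> \<open>The two displacements from \<open>?u\<close> differ by
      \<open>\<eta> t *\<^sub>R ?s t\<close>, which is orthogonal to \<open>?g t\<close>; hence the
      linear terms of the smoothness and tangent inequalities coincide.\<close>
    moreover have "?g t \<bullet> (\<eta> t *\<^sub>R (?s t - m t)) = ?g t \<bullet> (\<eta> t *\<^sub>R ?S (t - 1) - ?u)"
      using orth by (simp add: inner_diff_right inner_add_right algebra_simps)
    ultimately show ?thesis
      by simp
  qed
  \<comment> \<open>The outer factor is the current \<open>\<eta> t\<close> instead of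
    \<open>\<eta> T\<close>, so that the bound can be carried from round to round.\<close>
  have "F (\<eta> t *\<^sub>R ?S t) \<le> L / 2 * (\<Sum>k=1..t. \<eta> t * \<eta> k * ?e k)"
    if "1 \<le> t" "t \<le> T" for t
    using that
  proof (induction t rule: nat_induct_at_least)
    case base
    then show ?case
      using round[of 1] F0 by (simp add: power2_eq_square)
  next
    case (Suc t)
    let ?q = "\<eta> (Suc t) / \<eta> t"
    have pos: "0 < \<eta> t" "0 < \<eta> (Suc t)" using \<eta>_pos Suc by auto
    \<comment> \<open>The old regret is first rescaled to the new step size; the factor
      \<open>?q\<close> then turns the outer \<open>\<eta> t\<close> of the induction hypothesis
      into \<open>\<eta> (Suc t)\<close>.\<close>
    have "F (\<eta> (Suc t) *\<^sub>R ?S t) \<le> ?q * F (\<eta> t *\<^sub>R ?S t)"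
      using assms(5,11) F0 pos Suc by (intro convex_on_scale_le) auto
    also have "\<dots> \<le> ?q * (L / 2 * (\<Sum>k=1..t. \<eta> t * \<eta> k * ?e k))"
      using Suc pos by (intro mult_left_mono) auto
    also have "\<dots> = L / 2 * (\<Sum>k=1..t. \<eta> (Suc t) * \<eta> k * ?e k)"
      using pos by (simp add: sum_distrib_left mult_ac)
    finally show ?case
      using round[of "Suc t"] Suc by (simp add: power2_eq_square algebra_simps)
  qed
  then show ?thesis
    using assms(10) by blast
qed

end
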